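(* Let $m\ge 2$ and let $S_{1,mP_3}$ be the star graph with $m$ rays of length $2$: vertex set $\{u\}\cup\{v_1^1,\dots,v_m^1\}\cup\{v_1^2,\dots,v_m^2\}$ ($2m+1$ vertices) and edges $uv_i^1$ and $v_i^1v_i^2$ for $i=1,\dots,m$. Let $Q=\{u\}$ (its minimum 3-covering) and let $A$ be the $(2m+1)\times(2m+1)$ matrix with $A_{xy}=1$ if $xy$ is an edge, $A_{uu}=1$, and all other entries $0$. Then the minimum 3-covering energy of $S_{1,mP_3}$, namely the sum of the absolute values of the eigenvalues of $A$, equals $$2m-2+|x_1|+|x_2|+|x_3|,$$ where $x_1,x_2,x_3$ are the roots of the cubic equation $\lambda^3-\lambda^2-(m+1)\lambda+1=0$.
   Context: A 3-covering of a graph $G$ is a set $Q$ of vertices such that every path on 3 distinct vertices contains at least one vertex of $Q$; a minimum 3-covering is one of minimum cardinality. The minimum 3-covering matrix $A_Q^3(G)$ has $(i,j)$ entry $1$ if $v_iv_j\in E(G)$, $1$ if $i=j$ and $v_i\in Q$, and $0$ otherwise; the minimum 3-covering energy is the sum of the absolute values of the eigenvalues of this matrix. *)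

theory Defs
  imports
    "Jordan_Normal_Form.Spectral_Radius"
    "Graph_Theory.Pair_Digraph"
    "Graph_Theory.Vertex_Walk"
begin

text \<open>A finite simple graph is a \<^locale>\<open>pair_graph\<close>: each undirected edge is represented by both
  of its orientations. All notions below are meant for such graphs.\<close>

definition three_covering :: "'a pair_pre_digraph \<Rightarrow> 'a set \<Rightarrow> bool" where
  "three_covering G Q \<longleftrightarrow>
     Q \<subseteq> pverts G \<and> (\<forall>p. vpath p (with_proj G) \<and> length p = 3 \<longrightarrow> set p \<inter> Q \<noteq> {})"

definition min_three_covering :: "'a pair_pre_digraph \<Rightarrow> 'a set \<Rightarrow> bool" where
  "min_three_covering G Q \<longleftrightarrow>
     three_covering G Q \<and> (\<forall>Q'. three_covering G Q' \<longrightarrow> card Q \<le> card Q')"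

text \<open>The list \<open>vs\<close> enumerates the vertices without repetition; it fixes the numbering of the rows
  and columns.\<close>

definition covering_matrix :: "'a pair_pre_digraph \<Rightarrow> 'a set \<Rightarrow> 'a list \<Rightarrow> real mat" where
  "covering_matrix G Q vs = mat (length vs) (length vs) (\<lambda>(i, j).
     if (vs ! i, vs ! j) \<in> parcs G then 1
     else if i = j \<and> vs ! i \<in> Q then 1
     else 0)"

text \<open>Eigenvalues are taken over the complex numbers and counted with algebraic multiplicity, i.e. the
  multiplicity as a root of the characteristic polynomial.\<close>

definition matrix_energy :: "real mat \<Rightarrow> real" where
  "matrix_energy A = (let B = map_mat complex_of_real A in
     \<Sum>k\<in>spectrum B. real (Polynomial.order k (char_poly B)) * cmod k)"

definition three_covering_energy :: "'a pair_pre_digraph \<Rightarrow> 'a set \<Rightarrow> 'a list \<Rightarrow> real" where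
  "three_covering_energy G Q vs = matrix_energy (covering_matrix G Q vs)"

text \<open>\<open>Center\<close> is $u$, \<open>Inner i\<close> is $v_i^1$ and \<open>Outer i\<close> is $v_i^2$.\<close>

datatype star_vertex = Center | Inner nat | Outer nat

definition star_graph :: "nat \<Rightarrow> star_vertex pair_pre_digraph" where
  "star_graph m =
     (let E = {(Center, Inner i) |i. i \<in> {1..m}} \<union> {(Inner i, Outer i) |i. i \<in> {1..m}}
      in \<lparr> pverts = {Center} \<union> Inner ` {1..m} \<union> Outer ` {1..m}, parcs = E \<union> E\<inverse> \<rparr>)"

lemma pair_graph_star_graph: "pair_graph (star_graph m)"
proof
  show "finite (parcs (star_graph m))"
    by (simp add: star_graph_def Let_def)
  show "symmetric (with_proj (star_graph m))"
    by (auto simp: star_graph_def Let_def symmetric_def sym_def)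
qed (auto simp: star_graph_def Let_def)

lemma card_pverts_star_graph: "card (pverts (star_graph m)) = 2 * m + 1"
proof -
  have "card (Inner ` {1..m} \<union> Outer ` {1..m}) = m + m"
    by (subst card_Un_disjoint) (auto simp: card_image inj_on_def)
  moreover have "pverts (star_graph m) = insert Center (Inner ` {1..m} \<union> Outer ` {1..m})"
    by (simp add: star_graph_def Let_def)
  ultimately show ?thesis by (simp add: image_iff)
qed

end

theory Submission
  imports Defs
begin

text \<open>Write \<open>M = x I - A\<close>. The column operations collected in a matrix \<open>T\<close> (\<open>star_elim_entry\<close>), which is
  triangular with diagonal \<open>x\<^sup>2 - 1\<close> (center), \<open>x\<close> (inner vertices), \<open>1\<close> (outer vertices), clear all
  entries of \<open>M\<close> below the diagonal: \<open>M T\<close> is triangular with diagonal \<open>x\<^sup>3 - x\<^sup>2 - (m+1) x + 1\<close>,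
  \<open>x\<^sup>2 - 1\<close>, \<open>x\<close>. Comparing determinants and cancelling \<open>x\<^sup>m (x\<^sup>2 - 1)\<close>, the characteristic
  polynomial is \<open>(x\<^sup>2 - 1)\<^bsup>m-1\<^esup>\<close> times the cubic, and the roots \<open>1\<close> and \<open>-1\<close> contribute \<open>2m - 2\<close>.\<close>

section \<open>Matrices with rows and columns labelled by list elements\<close>

text \<open>Entries depend on labels rather than positions, so they can be given by cases on
  vertices, and the order of the list can be changed later.\<close>

definition list_mat :: "'a list \<Rightarrow> 'a list \<Rightarrow> ('a \<Rightarrow> 'a \<Rightarrow> 'b) \<Rightarrow> 'b mat" where
  "list_mat us vs f = mat (length us) (length vs) (\<lambda>(i, j). f (us ! i) (vs ! j))"

lemma list_mat_carrier [simp]: "list_mat us vs f \<in> carrier_mat (length us) (length vs)"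
  by (simp add: list_mat_def)

lemma list_mat_cong:
  assumes "\<And>u v. u \<in> set us \<Longrightarrow> v \<in> set vs \<Longrightarrow> f u v = g u v"
  shows "list_mat us vs f = list_mat us vs g"
  using assms by (auto simp: list_mat_def intro!: eq_matI)

text \<open>These rules push a factor into a conditional, so that a sum against an indicator
  collapses to one term.\<close>

lemmas if_mult_distrib =
  if_distrib[where f = "\<lambda>x. x * _"] if_distrib[where f = "\<lambda>x. _ * x"]

lemma list_mat_mult:
  fixes f g :: "'a \<Rightarrow> 'a \<Rightarrow> 'b::comm_ring_1"
  assumes "distinct vs"
  shows "list_mat us vs f * list_mat vs ws g
    = list_mat us ws (\<lambda>u w. \<Sum>v\<in>set vs. f u v * g v w)"
proof (rule eq_matI)
  fix i j
  assume "i < dim_row (list_mat us ws (\<lambda>u w. \<Sum>v\<in>set vs. f u v * g v w))"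
    and "j < dim_col (list_mat us ws (\<lambda>u w. \<Sum>v\<in>set vs. f u v * g v w))"
  moreover have "(\<Sum>k = 0..<length vs. h (vs ! k)) = sum h (set vs)" for h :: "'a \<Rightarrow> 'b"
    using assms
    by (intro sum.reindex_bij_betw bij_betw_nth) auto
  ultimately show "(list_mat us vs f * list_mat vs ws g) $$ (i, j)
      = list_mat us ws (\<lambda>u w. \<Sum>v\<in>set vs. f u v * g v w) $$ (i, j)"
    by (simp add: list_mat_def scalar_prod_def)
qed (simp_all add: list_mat_def)

lemma list_mat_one:
  assumes "distinct vs"
  shows "list_mat vs vs (\<lambda>u v. of_bool (u = v)) = 1\<^sub>m (length vs)"
  using assms by (auto simp: list_mat_def nth_eq_iff_index_eq intro!: eq_matI)

text \<open>With \<open>?P\<close> and \<open>?Q\<close> the permutation matrices between the two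
  orders, the matrix over \<open>vs\<close> is \<open>?P\<close> times the one over
  \<open>ws\<close> times \<open>?Q\<close>. As \<open>?P * ?Q\<close> is the identity, their
  determinants cancel.\<close>

lemma det_list_mat_reorder:
  fixes f :: "'a \<Rightarrow> 'a \<Rightarrow> 'b::comm_ring_1"
  assumes "distinct vs" "distinct ws" "set vs = set ws"
  shows "det (list_mat vs vs f) = det (list_mat ws ws f)"
proof -
  let ?I = "\<lambda>u v::'a. of_bool (u = v) :: 'b"
  let ?P = "list_mat vs ws ?I" and ?Q = "list_mat ws vs ?I"
  let ?n = "length vs"
  have len: "length ws = ?n"
    using assms by (metis distinct_card)
  have carrier: "?P \<in> carrier_mat ?n ?n" "?Q \<in> carrier_mat ?n ?n"
      "list_mat ws ws f \<in> carrier_mat ?n ?n" "list_mat ws vs f \<in> carrier_mat ?n ?n"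
    by (metis list_mat_carrier len)+
  have "?P * ?Q = list_mat vs vs ?I"
    unfolding list_mat_mult[OF assms(2)]
    using assms by (intro list_mat_cong) (auto simp: of_bool_def if_mult_distrib cong: if_cong)
  then have PQ: "det ?P * det ?Q = 1"
    using assms carrier by (metis det_mult det_one list_mat_one)
  have "list_mat ws ws f * ?Q = list_mat ws vs f"
    unfolding list_mat_mult[OF assms(2)]
    using assms by (intro list_mat_cong) (auto simp: of_bool_def if_mult_distrib cong: if_cong)
  moreover have "?P * list_mat ws vs f = list_mat vs vs f"
    unfolding list_mat_mult[OF assms(2)]
    using assms by (intro list_mat_cong) (auto simp: of_bool_def if_mult_distrib cong: if_cong)
  ultimately have "det (list_mat vs vs f) = det ?P * (det (list_mat ws ws f) * det ?Q)"
    using carrier by (metis det_mult)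
  with PQ show ?thesis
    by (metis mult.commute mult.left_commute mult_1)
qed

text \<open>Sorting the labels by \<open>rank\<close> makes the matrix upper triangular. Entries
  between distinct labels of equal rank vanish too, so the order among ties is irrelevant.\<close>

lemma det_list_mat_triangular:
  fixes f :: "'a \<Rightarrow> 'a \<Rightarrow> 'b::comm_ring_1" and rank :: "'a \<Rightarrow> nat"
  assumes "distinct vs"
    and tri: "\<And>u v. u \<in> set vs \<Longrightarrow> v \<in> set vs \<Longrightarrow> u \<noteq> v \<Longrightarrow> rank v \<le> rank u \<Longrightarrow> f u v = 0"
  shows "det (list_mat vs vs f) = (\<Prod>v\<in>set vs. f v v)"
proof -
  define ws where "ws = sort_key rank vs"
  have ws: "distinct ws" "set ws = set vs" "sorted (map rank ws)"
    using assms by (auto simp: ws_def)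
  have "upper_triangular (list_mat ws ws f)"
  proof -
    have "f (ws ! i) (ws ! j) = 0" if "i < length ws" "j < i" for i j
    proof (rule tri)
      show "rank (ws ! j) \<le> rank (ws ! i)"
        using sorted_nth_mono[OF ws(3), of j i] that by simp
      show "ws ! i \<noteq> ws ! j"
        using that ws(1) by (simp add: nth_eq_iff_index_eq)
      show "ws ! i \<in> set vs" "ws ! j \<in> set vs"
        using that unfolding ws(2)[symmetric] by (auto intro: nth_mem)
    qed
    then show ?thesis
      by (auto simp: upper_triangular_def list_mat_def)
  qed
  then have "det (list_mat ws ws f) = prod_list (diag_mat (list_mat ws ws f))"
    using list_mat_carrier by (rule det_upper_triangular)
  also have "diag_mat (list_mat ws ws f) = map (\<lambda>v. f v v) ws"
    by (auto simp: diag_mat_def list_mat_def intro!: nth_equalityI)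
  also have "prod_list (map (\<lambda>v. f v v) ws) = (\<Prod>v\<in>set vs. f v v)"
    using ws by (simp add: prod.distinct_set_conv_list flip: ws(2))
  finally show ?thesis
    using det_list_mat_reorder[of vs ws f] assms ws by simp
qed

section \<open>The characteristic polynomial of the star\<close>

fun star_char_entry :: "star_vertex \<Rightarrow> star_vertex \<Rightarrow> complex poly" where
  "star_char_entry Center Center = [:-1, 1:]"
| "star_char_entry Center (Inner j) = -1"
| "star_char_entry (Inner i) Center = -1"
| "star_char_entry (Inner i) (Inner j) = (if i = j then [:0, 1:] else 0)"
| "star_char_entry (Inner i) (Outer j) = (if i = j then -1 else 0)"
| "star_char_entry (Outer i) (Inner j) = (if i = j then -1 else 0)"
| "star_char_entry (Outer i) (Outer j) = (if i = j then [:0, 1:] else 0)"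
| "star_char_entry _ _ = 0"

text \<open>In the \<open>Center\<close> column, the value x^2 - 1 at the center forces x and 1 on
  each ray if the two rows of that ray are to vanish; this scaling avoids denominators. In the
  column of \<open>Inner j\<close>, the values x and 1 clear the row of
  \<open>Outer j\<close>.\<close>

fun star_elim_entry :: "star_vertex \<Rightarrow> star_vertex \<Rightarrow> complex poly" where
  "star_elim_entry Center Center = [:-1, 0, 1:]"
| "star_elim_entry (Inner i) Center = [:0, 1:]"
| "star_elim_entry (Outer i) Center = 1"
| "star_elim_entry (Inner i) (Inner j) = (if i = j then [:0, 1:] else 0)"
| "star_elim_entry (Outer i) (Inner j) = (if i = j then 1 else 0)"
| "star_elim_entry (Outer i) (Outer j) = (if i = j then 1 else 0)"
| "star_elim_entry _ _ = 0"

fun depth :: "star_vertex \<Rightarrow> nat" where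
  "depth Center = 0"
| "depth (Inner i) = 1"
| "depth (Outer i) = 2"

lemma pverts_star_graph:
  "pverts (star_graph m) = insert Center (Inner ` {1..m} \<union> Outer ` {1..m})"
  by (simp add: star_graph_def Let_def)

lemma parcs_star_graph:
  "(u, v) \<in> parcs (star_graph m) \<longleftrightarrow> (\<exists>i\<in>{1..m}.
     (u, v) \<in> {(Center, Inner i), (Inner i, Center), (Inner i, Outer i), (Outer i, Inner i)})"
  by (auto simp: star_graph_def Let_def)

lemma
  fixes f :: "star_vertex \<Rightarrow> 'b::comm_ring_1"
  shows sum_pverts_star_graph: "sum f (pverts (star_graph m))
      = f Center + (\<Sum>i\<in>{1..m}. f (Inner i)) + (\<Sum>i\<in>{1..m}. f (Outer i))" (is ?sum)
    and prod_pverts_star_graph: "prod f (pverts (star_graph m))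
      = f Center * (\<Prod>i\<in>{1..m}. f (Inner i)) * (\<Prod>i\<in>{1..m}. f (Outer i))" (is ?prod)
proof -
  have *: "inj_on Inner A" "inj_on Outer A" "Inner ` A \<inter> Outer ` B = {}"
      "Center \<notin> Inner ` A \<union> Outer ` B" for A B
    by (auto simp: inj_on_def)
  show ?sum
    using * by (simp add: pverts_star_graph sum.union_disjoint sum.reindex add.assoc)
  show ?prod
    using * by (simp add: pverts_star_graph prod.union_disjoint prod.reindex mult.assoc)
qed

lemma char_poly_matrix_star_graph:
  assumes "distinct vs" "set vs = pverts (star_graph m)"
  shows "char_poly_matrix (map_mat complex_of_real (covering_matrix (star_graph m) {Center} vs))
    = list_mat vs vs star_char_entry"
proof -
  have "[:0, 1:] * of_bool (u = v) + [:- complex_of_real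
      (if (u, v) \<in> parcs (star_graph m) then 1 else if u = v \<and> u \<in> {Center} then 1 else 0):]
      = star_char_entry u v" if "u \<in> set vs" "v \<in> set vs" for u v
    using that unfolding assms(2)
    by (cases u; cases v) (auto simp: parcs_star_graph pverts_star_graph)
  note entry = this
  show ?thesis
  proof (rule eq_matI)
    fix i j
    assume "i < dim_row (list_mat vs vs star_char_entry)"
      "j < dim_col (list_mat vs vs star_char_entry)"
    then have ij: "i < length vs" "j < length vs"
      by (auto simp: list_mat_def)
    show "char_poly_matrix (map_mat complex_of_real
        (covering_matrix (star_graph m) {Center} vs)) $$ (i, j)
        = list_mat vs vs star_char_entry $$ (i, j)"
      using ij entry[of "vs ! i" "vs ! j"] assms(1)
      by (simp add: char_poly_matrix_def covering_matrix_def list_mat_def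
          nth_eq_iff_index_eq of_bool_def cong: if_cong)
  qed (auto simp: char_poly_matrix_def covering_matrix_def list_mat_def)
qed

lemma char_poly_star_graph:
  assumes "m \<ge> 1" "distinct vs" "set vs = pverts (star_graph m)"
  shows "char_poly (map_mat complex_of_real (covering_matrix (star_graph m) {Center} vs))
    = [:-1, 0, 1:] ^ (m - 1) * [:1, - (of_nat m + 1), -1, 1:]" (is "_ = ?q ^ _ * ?c")
proof -
  let ?M = "star_char_entry" and ?T = "star_elim_entry"
  let ?X = "[:0, 1:] :: complex poly"
  define N where "N u w = (\<Sum>v\<in>set vs. ?M u v * ?T v w)" for u w
  have "det (list_mat vs vs ?T) = (\<Prod>v\<in>set vs. ?T v v)"
  \<comment> \<open>Off the diagonal, \<open>?T\<close> is nonzero only where the row is deeper than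
    the column, so \<open>depth\<close> is reversed; the natural subtraction is exact as
    \<open>depth\<close> is at most 2.\<close>
  proof (rule det_list_mat_triangular[OF assms(2), where rank = "\<lambda>v. 2 - depth v"])
    show "?T u v = 0" if "u \<noteq> v" "2 - depth v \<le> 2 - depth u" for u v
      using that by (cases u; cases v) auto
  qed
  then have detT: "det (list_mat vs vs ?T) = ?q * ?X ^ m"
    unfolding assms(3) by (simp add: prod_pverts_star_graph)
  \<comment> \<open>These are the entries whose column is no deeper than the row. At the center,
    each of the \<open>m\<close> rays adds -x to (x - 1)(x^2 - 1), which gives the cubic.\<close>
  have N_simps: "N Center Center = ?c"
    "\<And>i. i \<in> {1..m} \<Longrightarrow> N (Inner i) Center = 0"
    "\<And>i. i \<in> {1..m} \<Longrightarrow> N (Outer i) Center = 0"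
    "\<And>i j. i \<in> {1..m} \<Longrightarrow> j \<in> {1..m} \<Longrightarrow> N (Inner i) (Inner j) = (if i = j then ?q else 0)"
    "\<And>i j. i \<in> {1..m} \<Longrightarrow> j \<in> {1..m} \<Longrightarrow> N (Outer i) (Inner j) = 0"
    "\<And>i j. i \<in> {1..m} \<Longrightarrow> j \<in> {1..m} \<Longrightarrow> N (Outer i) (Outer j) = (if i = j then ?X else 0)"
    unfolding N_def assms(3) sum_pverts_star_graph
    by (auto simp: if_mult_distrib
        if_distrib[where f = "pCons 0"] of_nat_poly one_pCons cong: if_cong)
  have "det (list_mat vs vs N) = (\<Prod>v\<in>set vs. N v v)"
  proof (rule det_list_mat_triangular[OF assms(2), where rank = depth])
    show "N u v = 0" if "u \<in> set vs" "v \<in> set vs" "u \<noteq> v" "depth v \<le> depth u" for u v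
      using that unfolding assms(3) pverts_star_graph
      by (cases u; cases v) (auto simp: N_simps)
  qed
  then have "det (list_mat vs vs N) = ?c * ?q ^ m * ?X ^ m"
    unfolding assms(3) by (simp add: prod_pverts_star_graph N_simps)
  moreover have "list_mat vs vs N = list_mat vs vs ?M * list_mat vs vs ?T"
    unfolding list_mat_mult[OF assms(2)] N_def ..
  ultimately have "det (list_mat vs vs ?M) * (?q * ?X ^ m) = ?c * ?q ^ m * ?X ^ m"
    using det_mult[of "list_mat vs vs ?M" "length vs" "list_mat vs vs ?T"] detT by simp
  \<comment> \<open>One factor is split off to match the one in the determinant of
    \<open>?T\<close>; the exponent is right because m \<ge> 1.\<close>
  also have "?q ^ m = ?q * ?q ^ (m - 1)"
    using assms(1) by (cases m) simp_all
  also have "?c * (?q * ?q ^ (m - 1)) * ?X ^ m = (?q ^ (m - 1) * ?c) * (?q * ?X ^ m)"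
    by (simp only: mult_ac)
  \<comment> \<open>Complex polynomials form an integral domain, so the nonzero factor
    \<open>?q * ?X ^ m\<close> cancels.\<close>
  finally have "det (list_mat vs vs ?M) = ?q ^ (m - 1) * ?c"
    by (rule mult_right_cancel[THEN iffD1, rotated]) (simp only: mult_eq_0_iff power_eq_0_iff, simp)
  then show ?thesis
    by (simp only: char_poly_def char_poly_matrix_star_graph[OF assms(2,3)])
qed

section \<open>The energy as a sum over the multiset of roots\<close>

lemma sum_mset_count:
  fixes f :: "'a \<Rightarrow> 'b::comm_semiring_1"
  shows "(\<Sum>x\<in>#A. f x) = (\<Sum>x\<in>set_mset A. of_nat (count A x) * f x)"
proof (induction A)
  case (add a A)
  have "(\<Sum>x\<in>insert a (set_mset A). of_nat (count (add_mset a A) x) * f x)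
      = (\<Sum>x\<in>insert a (set_mset A). of_nat (count A x) * f x + (if x = a then f x else 0))"
    by (intro sum.cong) (auto simp: algebra_simps)
  also have "\<dots> = (\<Sum>x\<in>insert a (set_mset A). of_nat (count A x) * f x) + f a"
    by (simp add: sum.distrib)
  \<comment> \<open>If \<open>a\<close> is not in \<open>A\<close>, its count there is 0 and the
    extra term vanishes.\<close>
  also have "(\<Sum>x\<in>insert a (set_mset A). of_nat (count A x) * f x)
      = (\<Sum>x\<in>set_mset A. of_nat (count A x) * f x)"
    by (rule sum.mono_neutral_right) (auto simp: not_in_iff)
  finally show ?case
    by (simp add: add.IH add.commute)
qed simp

lemma matrix_energy_proots:
  assumes "A \<in> carrier_mat n n"
  shows "matrix_energy A
    = (\<Sum>x\<in>#proots (char_poly (map_mat complex_of_real A)). cmod x)"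
proof -
  let ?B = "map_mat complex_of_real A"
  have B: "?B \<in> carrier_mat n n"
    using assms by simp
  \<comment> \<open>For a nonzero polynomial, the count of a root in \<open>proots\<close> is its
    order.\<close>
  have "char_poly ?B \<noteq> 0"
    using degree_monic_char_poly[OF B] by auto
  then show ?thesis
    by (simp add: matrix_energy_def Let_def sum_mset_count spectrum_root_char_poly[OF B])
qed

section \<open>The center as a minimum 3-covering\<close>

text \<open>Removing the center leaves only disjoint edges between \<open>Inner i\<close> and
  \<open>Outer i\<close>, which contain no path on three vertices.\<close>

lemma three_covering_star_graph: "three_covering (star_graph m) {Center}"
  unfolding three_covering_def
proof (intro conjI allI impI)
  show "{Center} \<subseteq> pverts (star_graph m)"
    by (simp add: pverts_star_graph)
next
  fix p
  assume p: "vpath p (with_proj (star_graph m)) \<and> length p = 3"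
  then obtain a b c where "p = [a, b, c]"
    by (auto simp: numeral_3_eq_3 length_Suc_conv)
  with p show "set p \<inter> {Center} \<noteq> {}"
    by (cases a; cases b; cases c) (auto simp: vpath_def vwalk_def parcs_star_graph)
qed

lemma three_covering_star_graph_nonempty:
  assumes "m \<ge> 2" "three_covering (star_graph m) Q"
  shows "Q \<noteq> {}"
proof -
  \<comment> \<open>Both ends of this path are vertices because m \<ge> 2.\<close>
  have "vpath [Inner 1, Center, Inner 2] (with_proj (star_graph m))"
    using assms(1) by (auto simp: vpath_def vwalk_def parcs_star_graph pverts_star_graph)
  moreover have "length [Inner 1, Center, Inner 2] = 3"
    by simp
  ultimately have "set [Inner 1, Center, Inner 2] \<inter> Q \<noteq> {}"
    using assms(2) unfolding three_covering_def by blast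
  then show ?thesis
    by blast
qed

theorem theorem8:
  fixes m :: nat and vs :: "star_vertex list" and x1 x2 x3 :: complex
  assumes "m \<ge> 2"
    and "distinct vs" and "set vs = pverts (star_graph m)"
    and "proots [:1, - (of_nat m + 1), -1, 1:] = {#x1, x2, x3#}"
  shows "min_three_covering (star_graph m) {Center} \<and>
    three_covering_energy (star_graph m) {Center} vs
      = 2 * real m - 2 + cmod x1 + cmod x2 + cmod x3"
proof
  have "card {Center} \<le> card Q" if Q: "three_covering (star_graph m) Q" for Q
  proof -
    \<comment> \<open>An infinite set would have \<open>card\<close> equal to 0, so nonemptiness
      alone does not give the bound 1.\<close>
    have "finite Q"
      using Q by (auto simp: three_covering_def pverts_star_graph intro: finite_subset)
    then show ?thesis
      using three_covering_star_graph_nonempty[OF assms(1) Q] by (simp add: Suc_le_eq card_gt_0_iff)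
  qed
  then show "min_three_covering (star_graph m) {Center}"
    by (simp add: min_three_covering_def three_covering_star_graph)
next
  let ?q = "[:-1, 0, 1:] :: complex poly" and ?c = "[:1, - (of_nat m + 1), -1, 1:] :: complex poly"
  have "proots ?q = proots ([:-1, 1:] * [:1, 1:])"
    by simp
  also have "\<dots> = {#1, -1#}"
    by (subst proots_mult) simp_all
  finally have proots: "proots (?q ^ (m - 1) * ?c) = repeat_mset (m - 1) {#1, -1#} + {#x1, x2, x3#}"
    using assms(4) by (subst proots_mult) (simp_all only: proots_power, simp_all)
  \<comment> \<open>Each copy of the pair contributes |1| + |-1| = 2.\<close>
  have sum_repeat: "(\<Sum>x\<in>#repeat_mset k {#1, -1#}. cmod x) = 2 * real k" for k
    by (induction k) auto
  have "covering_matrix (star_graph m) {Center} vs \<in> carrier_mat (length vs) (length vs)"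
    by (simp add: covering_matrix_def)
  then have "three_covering_energy (star_graph m) {Center} vs
      = (\<Sum>x\<in>#proots (?q ^ (m - 1) * ?c). cmod x)"
    using assms char_poly_star_graph[of m vs]
    by (simp add: three_covering_energy_def matrix_energy_proots)
  also have "\<dots> = 2 * real (m - 1) + (cmod x1 + cmod x2 + cmod x3)"
    unfolding proots by (simp only: image_mset_union sum_mset.union sum_repeat) simp
  finally show "three_covering_energy (star_graph m) {Center} vs
      = 2 * real m - 2 + cmod x1 + cmod x2 + cmod x3"
    using assms(1) by (simp add: of_nat_diff)
qed

end
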